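(* On $\beta(0,1)$-trees with $n$ nodes, the pair of statistics $(\mathrm{root},\mathrm{rmod})$ has the same joint distribution as the pair $(\mathrm{rmod},\mathrm{root})$. Equivalently, $$\sum_{T}x^{\mathrm{root}(T)}y^{\mathrm{rmod}(T)} = \sum_{T}x^{\mathrm{rmod}(T)}y^{\mathrm{root}(T)},$$ where both sums are over all $\beta(0,1)$-trees $T$ with $n$ nodes.
   Context: A $\beta(0,1)$-tree is a rooted plane tree (children linearly ordered left to right) whose nodes are labeled with nonnegative integers such that: leaves have label $0$; the label of the root is one more than the sum of its children's labels; the label of any other (non-leaf) node exceeds the sum of its children's labels by at most one. The trivial tree $\bullet$ has one node, whose label is $0$; all others are nontrivial. $\mathrm{root}(T)$ is the root label of $T$ (so $\mathrm{root}(\bullet)=0$). The rightmost path is the path from the root to the rightmost leaf. A node is excessive if its label exceeds the sum of its children's labels, and moderate otherwise; leaves are moderate and the root of a nontrivial tree is excessive. For nontrivial $T$, $\mathrm{rmod}(T)$ is the number of moderate nodes on the rightmost path of $T$; $\mathrm{rmod}(\bullet)=0$. *)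

theory Defs
  imports Main
begin

text \<open>
  A node of a tree is identified with the subtree hanging from it. The children are listed from
  left to right.
\<close>

datatype ltree = Node (label: nat) (children: "ltree list")

fun nodes :: "ltree \<Rightarrow> nat" where
  "nodes (Node a ts) = 1 + sum_list (map nodes ts)"

definition children_sum :: "ltree \<Rightarrow> nat" where
  "children_sum t = sum_list (map label (children t))"

text \<open>
  The label of an inner node other than the root may be any number from 0 up to one more than the
  sum of its children's labels; in particular it may be smaller than that sum.
\<close>

fun labels_ok :: "ltree \<Rightarrow> bool" where
  "labels_ok (Node a ts) \<longleftrightarrow>
     (if ts = [] then a = 0 else a \<le> children_sum (Node a ts) + 1) \<and> (\<forall>t \<in> set ts. labels_ok t)"

text \<open>The trivial tree has a root that is also a leaf; the rule for leaves takes precedence.\<close>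

definition beta01 :: "ltree \<Rightarrow> bool" where
  "beta01 T \<longleftrightarrow>
     (if children T = [] then label T = 0 else label T = children_sum T + 1) \<and>
     (\<forall>t \<in> set (children T). labels_ok t)"

definition beta01_trees :: "nat \<Rightarrow> ltree set" where
  "beta01_trees n = {T. beta01 T \<and> nodes T = n}"

definition root_label :: "ltree \<Rightarrow> nat" where
  "root_label T = label T"

definition excessive :: "ltree \<Rightarrow> bool" where
  "excessive t \<longleftrightarrow> label t > children_sum t"

definition moderate :: "ltree \<Rightarrow> bool" where
  "moderate t \<longleftrightarrow> \<not> excessive t"

function rightmost_path :: "ltree \<Rightarrow> ltree list" where
  "rightmost_path (Node a ts) = Node a ts # (if ts = [] then [] else rightmost_path (last ts))"
  by pat_completeness auto
termination
  by (relation "measure size") (auto simp: less_Suc_eq_le intro!: size_list_estimation'[OF last_in_set])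

definition rmod :: "ltree \<Rightarrow> nat" where
  "rmod T = (if children T = [] then 0 else length (filter moderate (rightmost_path T)))"

text \<open>
  Finiteness of the set of trees with a given number of nodes, so that its cardinalities and
  sums are meaningful.
\<close>

fun bounded_labels :: "nat \<Rightarrow> ltree \<Rightarrow> bool" where
  "bounded_labels m (Node a ts) \<longleftrightarrow> a \<le> m \<and> (\<forall>t \<in> set ts. bounded_labels m t)"

lemma nodes_pos: "nodes t \<ge> 1"
  by (cases t) simp

lemma length_le_sum_nodes: "length ts \<le> sum_list (map nodes ts)"
proof (induction ts)
  case (Cons t ts)
  then show ?case using nodes_pos[of t] by simp
qed simp

lemma nodes_child_le: "t \<in> set ts \<Longrightarrow> nodes t \<le> sum_list (map nodes ts)"
  by (induction ts) auto

lemma finite_bounded_labels: "finite {t. nodes t \<le> n \<and> bounded_labels m t}"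
proof (induction n)
  case 0
  have "(nodes t \<le> 0) = False" for t using nodes_pos[of t] by simp
  then show ?case by (simp del: le_zero_eq)
next
  case (Suc n)
  let ?S = "{t. nodes t \<le> n \<and> bounded_labels m t}"
  have "{t. nodes t \<le> Suc n \<and> bounded_labels m t}
      \<subseteq> (\<lambda>(a, ts). Node a ts) ` ({..m} \<times> {ts. set ts \<subseteq> ?S \<and> length ts \<le> n})"
  proof
    fix t assume t: "t \<in> {t. nodes t \<le> Suc n \<and> bounded_labels m t}"
    obtain a ts where eq: "t = Node a ts" by (cases t)
    have le: "sum_list (map nodes ts) \<le> n" using t eq by simp
    have "set ts \<subseteq> ?S" using t eq le nodes_child_le[of _ ts] by fastforce
    moreover have "length ts \<le> n" using le length_le_sum_nodes[of ts] by simp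
    moreover have "a \<le> m" using t eq by simp
    ultimately show "t \<in> (\<lambda>(a, ts). Node a ts) ` ({..m} \<times> {ts. set ts \<subseteq> ?S \<and> length ts \<le> n})"
      using eq by auto
  qed
  moreover have "finite ({..m} \<times> {ts. set ts \<subseteq> ?S \<and> length ts \<le> n})"
    using finite_lists_length_le[OF Suc.IH] by simp
  ultimately show ?case by (meson finite_imageI finite_subset)
qed

lemma label_le_nodes: "labels_ok t \<Longrightarrow> label t \<le> nodes t"
proof (induction t)
  case (Node a ts)
  have "sum_list (map label ts) \<le> sum_list (map nodes ts)"
    using Node by (intro sum_list_mono) auto
  then show ?case using Node.prems by (auto simp: children_sum_def split: if_splits)
qed

lemma labels_ok_bounded: "labels_ok t \<Longrightarrow> nodes t \<le> m \<Longrightarrow> bounded_labels m t"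
proof (induction t)
  case (Node a ts)
  have "a \<le> m" using label_le_nodes[OF Node.prems(1)] Node.prems(2) by simp
  moreover have "bounded_labels m t" if "t \<in> set ts" for t
    using Node that nodes_child_le[OF that] by force
  ultimately show ?case by simp
qed

lemma beta01_labels_ok: "beta01 T \<Longrightarrow> labels_ok T"
  by (cases T) (auto simp: beta01_def split: if_splits)

lemma finite_beta01_trees: "finite (beta01_trees n)"
  by (rule finite_subset[OF _ finite_bounded_labels[of n n]])
     (auto simp: beta01_trees_def intro: labels_ok_bounded beta01_labels_ok)

end

theory Submission
  imports Defs "HOL-Computational_Algebra.Formal_Power_Series"
    "HOL-Computational_Algebra.Polynomial"
begin

text \<open>
  Let \<open>B(u,v)\<close> enumerate nontrivial trees by \<open>root\<close>, \<open>rmod\<close> and (by the variable \<open>z\<close>) nodes. Splitting off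
  the last subtree of the root yields a functional equation which, with \<open>A(u) = uz + B(u,1)\<close>,
  \<open>D(v) = vz + B(1,v)\<close> and \<open>s = u + v - 1\<close>, reads \<open>B(u,v) (u - 1 - A(u) s) = A(u) v (z s - D(v))\<close>.
  At \<open>v = 1\<close> this is a quadratic equation for \<open>A(u)\<close>, which is equivalent to
  \<open>u (z s - A(u)) (u - 1 - A(u) s) / A(u) = (u - 1) (v - 1) - u v z s + A(1) s\<close>,
  where the right-hand side is symmetric in \<open>u\<close> and \<open>v\<close>. Hence the functional equation turns into its own
  mirror image as soon as \<open>D = A\<close>, and \<open>D = A\<close> follows by a uniqueness argument on orders in \<open>z\<close>.
\<close>

section \<open>Generating functions of sets of trees\<close>

definition gf :: "ltree set \<Rightarrow> (ltree \<Rightarrow> 'a::comm_ring_1) \<Rightarrow> 'a fps" where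
  "gf S w = Abs_fps (\<lambda>n. \<Sum>t | t \<in> S \<and> nodes t = n. w t)"

lemma gf_nth: "fps_nth (gf S w) n = (\<Sum>t | t \<in> S \<and> nodes t = n. w t)"
  by (simp add: gf_def)

text \<open>Sorting the pairs \<open>(a, b)\<close> by \<open>i = nodes a\<close> turns the sum over
  \<open>U\<close> into the Cauchy product.\<close>

lemma gf_mult:
  assumes bij: "bij_betw (\<lambda>(a, b). f a b) (S \<times> S') U"
    and nodes_f: "\<And>a b. a \<in> S \<Longrightarrow> b \<in> S' \<Longrightarrow> nodes (f a b) = nodes a + nodes b"
    and weight_f: "\<And>a b. a \<in> S \<Longrightarrow> b \<in> S' \<Longrightarrow> w (f a b) = v a * v' b"
    and fin: "\<And>n. finite {t. t \<in> S \<and> nodes t = n}" "\<And>n. finite {t. t \<in> S' \<and> nodes t = n}"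
  shows "gf U w = gf S v * gf S' v'"
proof (rule fps_ext)
  fix n
  let ?S = "\<lambda>n. {t. t \<in> S \<and> nodes t = n}" and ?S' = "\<lambda>n. {t. t \<in> S' \<and> nodes t = n}"
  let ?P = "SIGMA i:{0..n}. ?S i \<times> ?S' (n - i)"
  have inj: "inj_on (\<lambda>(a, b). f a b) (S \<times> S')" and U: "U = (\<lambda>(a, b). f a b) ` (S \<times> S')"
    using bij by (auto simp: bij_betw_def)
  have bij_n: "bij_betw (\<lambda>(i, a, b). f a b) ?P {t. t \<in> U \<and> nodes t = n}"
    unfolding bij_betw_def
  proof
    show "inj_on (\<lambda>(i, a, b). f a b) ?P"
    proof (rule inj_onI)
      fix p q assume p: "p \<in> ?P" and q: "q \<in> ?P"
        and eq: "(\<lambda>(i, a, b). f a b) p = (\<lambda>(i, a, b). f a b) q"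
      have "snd p = snd q"
        by (rule inj_onD[OF inj]) (use p q eq in auto)
      moreover have "fst p = nodes (fst (snd p))" "fst q = nodes (fst (snd q))"
        using p q by auto
      ultimately show "p = q" by (simp add: prod_eq_iff)
    qed
    show "(\<lambda>(i, a, b). f a b) ` ?P = {t. t \<in> U \<and> nodes t = n}"
    proof (intro equalityI subsetI)
      fix t assume "t \<in> {t. t \<in> U \<and> nodes t = n}"
      then obtain a b where ab: "t = f a b" "a \<in> S" "b \<in> S'" "nodes (f a b) = n"
        unfolding U by auto
      then have "(nodes a, a, b) \<in> ?P" using nodes_f by auto
      then show "t \<in> (\<lambda>(i, a, b). f a b) ` ?P" using ab(1) by force
    qed (auto simp: U nodes_f)
  qed
  have "fps_nth (gf S v * gf S' v') n
      = (\<Sum>i=0..n. \<Sum>(a, b) \<in> ?S i \<times> ?S' (n - i). v a * v' b)"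
    by (simp add: fps_mult_nth gf_nth sum_product sum.cartesian_product)
  also have "\<dots> = (\<Sum>(i, a, b) \<in> ?P. v a * v' b)"
    by (subst sum.Sigma) (auto intro!: fin finite_cartesian_product)
  also have "\<dots> = (\<Sum>p \<in> ?P. w ((\<lambda>(i, a, b). f a b) p))"
    by (rule sum.cong) (auto simp: weight_f)
  also have "\<dots> = fps_nth (gf U w) n"
    unfolding gf_nth by (rule sum.reindex_bij_betw[OF bij_n])
  finally show "fps_nth (gf U w) n = fps_nth (gf S v * gf S' v') n" ..
qed

section \<open>Decomposition of trees\<close>

definition nontrivial :: "ltree set" where
  "nontrivial = {T. beta01 T \<and> children T \<noteq> []}"

text \<open>Agrees with \<open>rmod\<close> on nontrivial trees but suits every subtree: a single
  leaf counts 1, where \<open>rmod\<close> gives 0.\<close>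

definition nmod :: "ltree \<Rightarrow> nat" where
  "nmod t = length (filter moderate (rightmost_path t))"

definition attach :: "ltree \<Rightarrow> ltree \<Rightarrow> ltree" where
  "attach T t = Node (Suc (children_sum T + label t)) (children T @ [t])"

lemma finite_labels_ok: "finite {t. labels_ok t \<and> nodes t = n}"
  by (rule finite_subset[OF _ finite_bounded_labels[of n n]]) (auto intro: labels_ok_bounded)

lemma finite_beta01: "finite {t. beta01 t \<and> nodes t = n}"
  using finite_beta01_trees[of n] by (simp add: beta01_trees_def)

lemma finite_nontrivial: "finite {t. t \<in> nontrivial \<and> nodes t = n}"
  by (rule finite_subset[OF _ finite_beta01[of n]]) (auto simp: nontrivial_def)

lemma nodes_eq: "nodes t = Suc (sum_list (map nodes (children t)))"
  by (cases t) simp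

lemma labels_ok_eq:
  "labels_ok t \<longleftrightarrow>
     (if children t = [] then label t = 0 else label t \<le> Suc (children_sum t)) \<and>
     (\<forall>c \<in> set (children t). labels_ok c)"
  by (cases t) simp

lemma nmod_eq:
  "nmod t = (if moderate t then 1 else 0) + (if children t = [] then 0 else nmod (last (children t)))"
  by (cases t) (simp add: nmod_def)

lemma rmod_nontrivial: "T \<in> nontrivial \<Longrightarrow> rmod T = nmod T"
  by (simp add: nontrivial_def rmod_def nmod_def)

text \<open>The root label of a tree is forced by its children, so deleting the last child of the
  root can be undone. What remains may be the trivial tree.\<close>

lemma attach_bij: "bij_betw (\<lambda>(T, t). attach T t) (Collect beta01 \<times> Collect labels_ok) nontrivial"
  unfolding bij_betw_def
proof
  have beta01_eqI: "T = T'" if "beta01 T" "beta01 T'" "children T = children T'" for T T'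
    using that by (cases T; cases T') (auto simp: beta01_def children_sum_def split: if_splits)
  show "inj_on (\<lambda>(T, t). attach T t) (Collect beta01 \<times> Collect labels_ok)"
    by (auto simp: inj_on_def attach_def intro: beta01_eqI)
  show "(\<lambda>(T, t). attach T t) ` (Collect beta01 \<times> Collect labels_ok) = nontrivial"
  proof (intro equalityI subsetI)
    fix T assume T: "T \<in> nontrivial"
    define ts where "ts = butlast (children T)"
    define t where "t = last (children T)"
    define R where "R = Node (if ts = [] then 0 else Suc (sum_list (map label ts))) ts"
    have ch: "children T = ts @ [t]"
      using T by (simp add: nontrivial_def ts_def t_def)
    have "beta01 R" "labels_ok t"
      using T ch by (auto simp: R_def nontrivial_def beta01_def children_sum_def)
    moreover have "T = attach R t"
      using T ch by (cases T) (auto simp: R_def attach_def nontrivial_def beta01_def children_sum_def)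
    ultimately show "T \<in> (\<lambda>(T, t). attach T t) ` (Collect beta01 \<times> Collect labels_ok)"
      by auto
  qed (auto simp: attach_def nontrivial_def beta01_def children_sum_def)
qed

lemma nodes_attach: "nodes (attach T t) = nodes T + nodes t"
  by (simp add: attach_def nodes_eq[of T])

text \<open>The new root is excessive, so only the part of the rightmost path inside
  \<open>t\<close> counts.\<close>

lemma nmod_attach: "nmod (attach T t) = nmod t"
  by (subst nmod_eq) (simp add: attach_def moderate_def excessive_def children_sum_def)

definition gfB :: "'a \<Rightarrow> 'a \<Rightarrow> 'a::comm_ring_1 fps" where
  "gfB u v = gf nontrivial (\<lambda>T. u ^ label T * v ^ nmod T)"

definition gfL :: "'a \<Rightarrow> 'a \<Rightarrow> 'a::comm_ring_1 fps" where
  "gfL u v = gf (Collect labels_ok) (\<lambda>t. u ^ label t * v ^ nmod t)"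

text \<open>The trivial tree is counted with weight \<open>u\<close> although its label is 0.\<close>

definition gfA :: "'a \<Rightarrow> 'a::comm_ring_1 fps" where
  "gfA u = gf (Collect beta01) (\<lambda>T. u ^ Suc (children_sum T))"

lemma gfB_eq_mult: "gfB u v = gfA u * gfL u v"
  unfolding gfA_def gfB_def gfL_def
proof (rule gf_mult[OF attach_bij])
  fix T t
  show "u ^ label (attach T t) * v ^ nmod (attach T t)
      = u ^ Suc (children_sum T) * (u ^ label t * v ^ nmod t)"
    by (simp only: nmod_attach) (simp add: attach_def power_add mult_ac)
qed (auto simp: nodes_attach finite_labels_ok finite_beta01)

lemma beta01_split:
  "{T. beta01 T \<and> nodes T = n}
     = {T. T \<in> nontrivial \<and> nodes T = n} \<union> (if n = 1 then {Node 0 []} else {})"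
proof (intro equalityI subsetI)
  fix T assume "T \<in> {T. beta01 T \<and> nodes T = n}"
  then show "T \<in> {T. T \<in> nontrivial \<and> nodes T = n} \<union> (if n = 1 then {Node 0 []} else {})"
    by (cases T) (auto simp: nontrivial_def beta01_def)
qed (auto simp: nontrivial_def beta01_def split: if_splits)

lemma gfA_eq: "gfA u = fps_const u * fps_X + gfB u 1"
proof (rule fps_ext)
  fix n
  have "(\<Sum>T | beta01 T \<and> nodes T = n. u ^ Suc (children_sum T))
      = (\<Sum>T | T \<in> nontrivial \<and> nodes T = n. u ^ Suc (children_sum T))
        + (\<Sum>T\<in>(if n = 1 then {Node 0 []} else {}). u ^ Suc (children_sum T))"
    unfolding beta01_split
    by (rule sum.union_disjoint) (use finite_nontrivial in auto, auto simp: nontrivial_def)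
  also have "(\<Sum>T | T \<in> nontrivial \<and> nodes T = n. u ^ Suc (children_sum T))
      = (\<Sum>T | T \<in> nontrivial \<and> nodes T = n. u ^ label T)"
    by (rule sum.cong) (auto simp: nontrivial_def beta01_def)
  finally show "fps_nth (gfA u) n = fps_nth (fps_const u * fps_X + gfB u 1) n"
    by (simp add: gfA_def gfB_def gf_nth children_sum_def)
qed

section \<open>Subtrees as relabelled nontrivial trees\<close>

definition relabel :: "ltree \<Rightarrow> nat \<Rightarrow> ltree" where
  "relabel T a = Node a (children T)"

lemma nmod_relabel:
  assumes "T \<in> nontrivial"
  shows "nmod (relabel T a) = (if a < label T then Suc (nmod T) else nmod T)"
  using assms nmod_eq[of T] nmod_eq[of "relabel T a"]
  by (auto simp: relabel_def nontrivial_def beta01_def moderate_def excessive_def children_sum_def)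

text \<open>The labels allowed at an inner node run from 0 to the label it would carry as a root. So
  a non-leaf subtree is a nontrivial tree whose root label was kept or lowered.\<close>

lemma labels_ok_split:
  "{t. labels_ok t \<and> nodes t = n}
     = (\<lambda>(T, a). relabel T a) ` (SIGMA T:{T. T \<in> nontrivial \<and> nodes T = n}. {..label T})
       \<union> (if n = 1 then {Node 0 []} else {})" (is "?L = ?R")
proof (intro equalityI subsetI)
  fix t assume t: "t \<in> ?L"
  show "t \<in> ?R"
  proof (cases "children t = []")
    case True
    then show ?thesis using t by (cases t) auto
  next
    case False
    let ?T = "relabel t (Suc (children_sum t))"
    have "?T \<in> nontrivial" "nodes ?T = n" "label t \<le> label ?T"
      using t False
      by (auto simp: nontrivial_def relabel_def beta01_def labels_ok_eq[of t] nodes_eq[of t]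
        children_sum_def)
    moreover have "t = relabel ?T (label t)"
      by (cases t) (simp add: relabel_def)
    ultimately show ?thesis by force
  qed
next
  fix t assume "t \<in> ?R"
  moreover have nodes_simp: "nodes T = n \<longleftrightarrow> n = Suc (sum_list (map nodes (children T)))" for T
    using nodes_eq[of T] by auto
  ultimately show "t \<in> ?L"
    by (auto simp: nontrivial_def relabel_def beta01_def nodes_simp
        children_sum_def split: if_splits)
qed

text \<open>The top label keeps the weight of \<open>T\<close>; each smaller one makes the root
  moderate, which gives a factor \<open>v\<close> and a geometric sum in \<open>u\<close>.
  Multiplying by \<open>u - 1\<close> evaluates that sum without division, and its lower end yields
  \<open>gfB 1 v\<close>.\<close>

lemma gfL_eq:
  "fps_const (u - 1) * gfL u v
     = fps_const (u - 1) * (fps_const v * fps_X + gfB u v) + fps_const v * (gfB u v - gfB 1 v)"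
proof (rule fps_ext)
  fix n
  let ?N = "{T. T \<in> nontrivial \<and> nodes T = n}"
  let ?w = "\<lambda>t. u ^ label t * v ^ nmod t"
  have inj: "inj_on (\<lambda>(T, a). relabel T a) (SIGMA T:?N. {..label T})"
  proof -
    have "T = T'" if "T \<in> nontrivial" "T' \<in> nontrivial" "children T = children T'" for T T'
      using that by (cases T; cases T') (auto simp: nontrivial_def beta01_def children_sum_def)
    then show ?thesis by (auto simp: inj_on_def relabel_def)
  qed
  have nmod0: "nmod (Node 0 []) = 1"
    by (simp add: nmod_def moderate_def excessive_def)
  have "fps_nth (gfL u v) n
      = sum ?w ((\<lambda>(T, a). relabel T a) ` (SIGMA T:?N. {..label T}))
        + sum ?w (if n = 1 then {Node 0 []} else {})"
    unfolding gfL_def gf_nth mem_Collect_eq labels_ok_split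
    by (rule sum.union_disjoint)
       (use finite_nontrivial in auto, auto simp: nontrivial_def relabel_def)
  also have "sum ?w ((\<lambda>(T, a). relabel T a) ` (SIGMA T:?N. {..label T}))
      = (\<Sum>T\<in>?N. \<Sum>a\<le>label T. ?w (relabel T a))"
    by (subst sum.reindex[OF inj], subst sum.Sigma)
       (auto simp: finite_nontrivial o_def split_def)
  also have "\<dots> = (\<Sum>T\<in>?N. ?w T + v * v ^ nmod T * (\<Sum>a<label T. u ^ a))"
  proof (rule sum.cong)
    fix T assume "T \<in> ?N"
    then have T: "T \<in> nontrivial" by simp
    have "(\<Sum>a\<le>label T. ?w (relabel T a)) = (\<Sum>a<label T. ?w (relabel T a)) + ?w (relabel T (label T))"
      by (simp add: lessThan_Suc_atMost[symmetric])
    also have "(\<Sum>a<label T. ?w (relabel T a)) = (\<Sum>a<label T. u ^ a * (v * v ^ nmod T))"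
      by (rule sum.cong) (auto simp: nmod_relabel[OF T], auto simp: relabel_def)
    also have "?w (relabel T (label T)) = ?w T"
      by (simp add: nmod_relabel[OF T]) (simp add: relabel_def)
    finally show "(\<Sum>a\<le>label T. ?w (relabel T a)) = ?w T + v * v ^ nmod T * (\<Sum>a<label T. u ^ a)"
      by (simp add: sum_distrib_left mult_ac)
  qed simp
  finally have L: "fps_nth (gfL u v) n
      = (\<Sum>T\<in>?N. ?w T + v * v ^ nmod T * (\<Sum>a<label T. u ^ a)) + (if n = 1 then v else 0)"
    by (simp add: nmod0)
  have geo: "(u - 1) * (v * v ^ nmod T * (\<Sum>a<label T. u ^ a))
      = v * (u ^ label T * v ^ nmod T - v ^ nmod T)" for T
  proof -
    have "(u - 1) * (v * v ^ nmod T * (\<Sum>a<label T. u ^ a))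
        = v * v ^ nmod T * ((u - 1) * (\<Sum>a<label T. u ^ a))"
      by (simp only: mult_ac)
    then show ?thesis
      unfolding power_diff_1_eq[symmetric] by (simp add: algebra_simps)
  qed
  have N: "(u - 1) * (\<Sum>T\<in>?N. ?w T + v * v ^ nmod T * (\<Sum>a<label T. u ^ a))
      = (u - 1) * (\<Sum>T\<in>?N. ?w T) + v * ((\<Sum>T\<in>?N. ?w T) - (\<Sum>T\<in>?N. v ^ nmod T))"
    by (simp only: sum.distrib distrib_left sum_distrib_left[of "u - 1"] geo
        sum_distrib_left[of v] sum_subtractf[symmetric])
  show "fps_nth (fps_const (u - 1) * gfL u v) n
     = fps_nth (fps_const (u - 1) * (fps_const v * fps_X + gfB u v)
         + fps_const v * (gfB u v - gfB 1 v)) n"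
    unfolding fps_mult_left_const_nth fps_add_nth fps_sub_nth L
    by (simp add: gfB_def gf_nth N distrib_left fps_mult_left_const_nth)
qed

section \<open>The functional equation and its symmetry\<close>

abbreviation gfD :: "'a \<Rightarrow> 'a::comm_ring_1 fps" where
  "gfD v \<equiv> fps_const v * fps_X + gfB 1 v"

abbreviation (input) sm :: "'a \<Rightarrow> 'a \<Rightarrow> 'a::comm_ring_1 fps" where
  "sm u v \<equiv> fps_const u + fps_const v - 1"

text \<open>Insert \<open>gfL_eq\<close> into \<open>gfB_eq_mult\<close>. Writing
  \<open>gfB 1 v\<close> as \<open>gfD v\<close> minus its linear term completes the factor
  \<open>u - 1\<close> of \<open>fps_X\<close> to \<open>sm u v\<close>.\<close>

lemma functional_equation:
  fixes u v :: "'a::comm_ring_1"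
  shows "gfB u v * (fps_const u - 1 - gfA u * sm u v)
     = gfA u * fps_const v * (fps_X * sm u v - gfD v)"
proof -
  have "(fps_const u - 1) * gfL u v
      = (fps_const u - 1) * (fps_const v * fps_X + gfB u v) + fps_const v * (gfB u v - gfB 1 v)"
    using gfL_eq[of u v] by (simp flip: fps_const_sub)
  with gfB_eq_mult[of u v] have "gfB u v * (fps_const u - 1)
      = gfA u * ((fps_const u - 1) * (fps_const v * fps_X + gfB u v)
          + fps_const v * (gfB u v - gfB 1 v))"
    by (metis mult.assoc mult.commute)
  then show ?thesis
    by (simp add: algebra_simps del: fps_const_add fps_const_sub fps_const_mult)
qed

lemma gfA_quadratic:
  fixes u :: "'a::comm_ring_1"
  shows "(gfA u - fps_const u * fps_X) * (fps_const u - 1 - gfA u * fps_const u)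
     = gfA u * (fps_X * fps_const u - gfA 1)"
  using functional_equation[of u 1] gfA_eq[of u] gfA_eq[of "1::'a"] by simp

text \<open>Here \<open>x\<close>, \<open>y\<close>, \<open>z\<close>, \<open>a\<close>,
  \<open>c\<close> stand for \<open>u\<close>, \<open>v\<close>, \<open>fps_X\<close>,
  \<open>gfA u\<close>, \<open>gfA 1\<close>. The two sides differ by a multiple, with factor
  \<open>x + y - 1\<close>, of the difference of the two sides of the assumption.\<close>

lemma kernel_symmetry:
  fixes a c x y z :: "'a::comm_ring_1"
  assumes "(a - x * z) * (x - 1 - a * x) = a * (z * x - c)"
  shows "x * (z * (x + y - 1) - a) * (x - 1 - a * (x + y - 1))
     = a * ((x - 1) * (y - 1) - x * y * z * (x + y - 1) + c * (x + y - 1))"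
proof -
  have "x * (z * (x + y - 1) - a) * (x - 1 - a * (x + y - 1))
      - a * ((x - 1) * (y - 1) - x * y * z * (x + y - 1) + c * (x + y - 1))
    = (x + y - 1) * (a * (z * x - c) - (a - x * z) * (x - 1 - a * x))"
    by (simp add: algebra_simps)
  then show ?thesis using assms by simp
qed

text \<open>By \<open>kernel_symmetry\<close> for \<open>u\<close> and for \<open>v\<close>, each
  side is \<open>gfA u * gfA v\<close> times the same symmetric factor.\<close>

lemma kernel_exchange:
  fixes u v :: "'a::comm_ring_1"
  shows "gfA u * fps_const v * (fps_X * sm u v - gfA v) * (fps_const v - 1 - gfA v * sm u v)
     = gfA v * fps_const u * (fps_X * sm u v - gfA u) * (fps_const u - 1 - gfA u * sm u v)"
proof -
  have "gfA u * (fps_const v * (fps_X * (fps_const v + fps_const u - 1) - gfA v)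
        * (fps_const v - 1 - gfA v * (fps_const v + fps_const u - 1)))
      = gfA v * (fps_const u * (fps_X * (fps_const u + fps_const v - 1) - gfA u)
        * (fps_const u - 1 - gfA u * (fps_const u + fps_const v - 1)))"
    unfolding kernel_symmetry[OF gfA_quadratic] by (simp only: ac_simps)
  then show ?thesis by (simp only: ac_simps)
qed

section \<open>Setting a polynomial variable to 1, and uniqueness\<close>

definition fps_at_1 :: "'a::comm_ring_1 poly fps \<Rightarrow> 'a fps" where
  "fps_at_1 f = Abs_fps (\<lambda>n. poly (fps_nth f n) 1)"

lemma fps_at_1_simps:
  "fps_at_1 (f + g) = fps_at_1 f + fps_at_1 g"
  "fps_at_1 (f - g) = fps_at_1 f - fps_at_1 g"
  "fps_at_1 (f * g) = fps_at_1 f * fps_at_1 g"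
  "fps_at_1 (fps_const p) = fps_const (poly p 1)"
  "fps_at_1 fps_X = fps_X"
  "fps_at_1 1 = 1"
  by (rule fps_ext; simp add: fps_at_1_def fps_mult_nth poly_sum)+

lemma fps_at_1_gfB: "fps_at_1 (gfB p q) = gfB (poly p 1) (poly q 1)"
  by (rule fps_ext) (simp add: fps_at_1_def gfB_def gf_nth poly_sum)

lemma fps_at_1_gfA: "fps_at_1 (gfA p) = gfA (poly p 1)"
  by (rule fps_ext) (simp add: fps_at_1_def gfA_def gf_nth poly_sum)

text \<open>Evaluation at 1 can annihilate coefficients but cannot create new ones, so the order
  never drops.\<close>

lemma subdegree_fps_at_1:
  "fps_at_1 f \<noteq> 0 \<Longrightarrow> subdegree f \<le> subdegree (fps_at_1 f)"
  by (rule subdegree_geI) (auto simp: fps_at_1_def nth_less_subdegree_zero)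

lemma gfA_nth_0: "fps_nth (gfA u) 0 = 0"
  using nodes_eq by (simp add: gfA_def gf_nth)

lemma sum_const_poly: "(\<Sum>t\<in>S. [:f t:]) = [:\<Sum>t\<in>S. f t:]"
  by (induction S rule: infinite_finite_induct) auto

lemma gfB_const_poly: "fps_nth (gfB [:p:] [:q:]) n = [:fps_nth (gfB p q) n:]"
  by (simp add: gfB_def gf_nth poly_const_pow sum_const_poly mult.commute)

lemma gfD_minus_gfA_const_poly:
  "fps_nth (gfD [:p:] - gfA [:p:]) n = [:fps_nth (gfD p - gfA p) n:]"
  using gfB_const_poly[of 1 p n] gfB_const_poly[of p 1 n]
  by (simp add: gfA_eq one_pCons)

text \<open>
  This says that \<open>root\<close> and \<open>rmod\<close> are equidistributed. With \<open>W\<close> the defect of the mirrored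
  functional equation in a polynomial variable \<open>u\<close>, the kernel exchange makes the order of \<open>W\<close> in
  \<open>fps_X\<close> exceed that of \<open>E\<close>, whereas \<open>W\<close> at \<open>u = 1\<close> has the same order as \<open>E\<close>.
\<close>

lemma gfD_eq_gfA:
  fixes p :: "'a::idom"
  assumes p1: "p \<noteq> 1"
  shows "gfD p = gfA p"
proof -
  \<comment> \<open>With \<open>u\<close> a polynomial variable, \<open>u - 1\<close> is nonzero,
    yet \<open>u = 1\<close> can still be substituted afterwards.\<close>
  define u where "u = [:0, 1::'a:]"
  define v where "v = [:p:]"
  define P where "P = fps_const u - 1 - gfA u * sm u v"
  define Q where "Q = fps_const v - 1 - gfA v * sm u v"
  define Q1 where "Q1 = fps_const p - 1 - gfA p * fps_const p"
  define W where "W = Q * gfB u v - gfA v * fps_const u * (fps_X * sm u v - gfA u)"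
  define E where "E = gfD v - gfA v"
  define E1 where "E1 = gfD p - gfA p"
  have P0: "fps_nth P 0 \<noteq> 0" and Q10: "fps_nth Q1 0 \<noteq> 0"
    using p1 by (simp_all add: P_def Q1_def u_def gfA_nth_0 one_pCons)
  \<comment> \<open>The functional equation contributes \<open>gfD v\<close>, the kernel exchange
    \<open>gfA v\<close> in the same place; only their difference survives.\<close>
  have WP: "W * P = - (Q * fps_const v * gfA u) * E"
  proof -
    have "W * P = Q * (gfB u v * P) - gfA v * fps_const u * (fps_X * sm u v - gfA u) * P"
      by (simp add: W_def algebra_simps)
    also have "\<dots> = Q * (gfA u * fps_const v * (fps_X * sm u v - gfD v))
        - gfA u * fps_const v * (fps_X * sm u v - gfA v) * Q"
      by (simp only: P_def Q_def functional_equation flip: kernel_exchange)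
    also have "\<dots> = - (Q * fps_const v * gfA u) * E"
      by (simp add: E_def algebra_simps)
    finally show ?thesis .
  qed
  have at1: "poly u 1 = 1" "poly v 1 = p"
    by (simp_all add: u_def v_def)
  \<comment> \<open>At \<open>u = 1\<close> the factor \<open>sm u v\<close> becomes
    \<open>p\<close>, and the quadratic equation for \<open>gfA p\<close> lets \<open>Q1\<close> be
    factored out.\<close>
  have W1: "fps_at_1 W = Q1 * E1"
  proof -
    have "fps_at_1 W = Q1 * gfB 1 p - gfA p * (fps_X * fps_const p - gfA 1)"
      by (simp add: W_def Q_def Q1_def fps_at_1_simps fps_at_1_gfA fps_at_1_gfB at1 del: fps_const_add)
    also have "\<dots> = Q1 * gfB 1 p - (gfA p - fps_const p * fps_X) * Q1"
      unfolding Q1_def gfA_quadratic ..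
    also have "\<dots> = Q1 * E1"
      by (simp add: E1_def algebra_simps)
    finally show ?thesis .
  qed
  \<comment> \<open>The coefficients of \<open>E\<close> are free of \<open>u\<close>, so
    \<open>E\<close> and \<open>E1\<close> have the same order.\<close>
  have E_const: "fps_nth E n = [:fps_nth E1 n:]" for n
    unfolding E_def E1_def v_def by (rule gfD_minus_gfA_const_poly)
  have "E1 = 0"
  proof (rule ccontr)
    assume False: "E1 \<noteq> 0"
    have "Q1 * E1 \<noteq> 0" using False Q10 by auto
    then have W_le: "subdegree W \<le> subdegree E1"
      using subdegree_fps_at_1[of W] W1 Q10 by (simp add: subdegree_mult)
    have "W \<noteq> 0" using W1 \<open>Q1 * E1 \<noteq> 0\<close> by (auto simp: fps_at_1_def fps_zero_def)
    moreover have "P \<noteq> 0" using P0 by auto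
    ultimately have "W * P \<noteq> 0" by simp
    \<comment> \<open>\<open>gfA u\<close> has no constant term, so the right-hand side of
      \<open>WP\<close> vanishes up to the order of \<open>E\<close>. The constant term of
      \<open>P\<close> is nonzero, so \<open>W * P\<close> has the order of
      \<open>W\<close>.\<close>
    have "subdegree E1 < subdegree (W * P)"
    proof -
      have "fps_nth (W * P) i = 0" if "i \<le> subdegree E1" for i
      proof -
        have "fps_nth E j = 0" if "j < i" for j
          using that \<open>i \<le> subdegree E1\<close> by (simp add: E_const nth_less_subdegree_zero)
        moreover have "fps_nth (- (Q * fps_const v * gfA u)) 0 = 0"
          by (simp add: gfA_nth_0)
        ultimately have "fps_nth (- (Q * fps_const v * gfA u)) j * fps_nth E (i - j) = 0"
          if "j \<le> i" for j
          using that by (cases "j = 0") auto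
        then show ?thesis unfolding WP fps_mult_nth by (intro sum.neutral) simp
      qed
      then show ?thesis using \<open>W * P \<noteq> 0\<close> by (intro subdegree_greaterI) auto
    qed
    also have "subdegree (W * P) = subdegree W"
      using \<open>W \<noteq> 0\<close> \<open>P \<noteq> 0\<close> P0 by simp
    finally show False using W_le by simp
  qed
  then show ?thesis unfolding E1_def by simp
qed

text \<open>Once \<open>gfD\<close> is \<open>gfA\<close>, the functional equation and its mirror
  image, each multiplied by the other's kernel, have the two sides of \<open>kernel_exchange\<close>
  on the right. The kernels have constant terms \<open>u - 1\<close> and \<open>v - 1\<close>, so
  they cancel.\<close>

lemma gfB_symmetric:
  fixes u v :: "'a::idom"
  assumes "u \<noteq> 1" "v \<noteq> 1"
  shows "gfB u v = gfB v u"
proof -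
  let ?P = "fps_const u - 1 - gfA u * sm u v" and ?Q = "fps_const v - 1 - gfA v * sm u v"
  have "fps_nth ?P 0 \<noteq> 0" "fps_nth ?Q 0 \<noteq> 0"
    using assms by (simp_all add: gfA_nth_0)
  then have "?P * ?Q \<noteq> 0" by (metis fps_zero_nth mult_eq_0_iff)
  moreover have "gfB u v * (?P * ?Q) = gfB v u * (?P * ?Q)"
  proof -
    have "gfB u v * (?P * ?Q) = (gfB u v * ?P) * ?Q"
      by (simp only: mult.assoc)
    also have "\<dots> = gfA u * fps_const v * (fps_X * sm u v - gfA v) * ?Q"
      by (simp only: functional_equation gfD_eq_gfA[OF assms(2)])
    also have "\<dots> = gfA v * fps_const u * (fps_X * sm v u - gfA u) * ?P"
      using kernel_exchange[of u v] by (simp only: add.commute)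
    also have "\<dots> = gfB v u * (fps_const v - 1 - gfA v * sm v u) * ?P"
      by (simp only: functional_equation gfD_eq_gfA[OF assms(1)])
    also have "\<dots> = gfB v u * (?P * ?Q)"
      by (simp only: mult_ac add.commute)
    finally show ?thesis .
  qed
  ultimately show ?thesis by simp
qed

section \<open>From power series to cardinalities\<close>

lemma coeff_sum_monom:
  assumes "finite S"
  shows "coeff (coeff (\<Sum>t\<in>S. [:0, 1:] ^ f t * [:[:0, 1:]:] ^ g t) i) j
    = int (card {t \<in> S. f t = i \<and> g t = j})"
proof -
  have "coeff (coeff ([:0, 1:] ^ k * [:[:0, 1:]:] ^ l) i) j = (if k = i \<and> l = j then 1 else (0::int))" for k l
  proof -
    have X: "[:0, 1:] ^ m = (monom 1 m :: 'b::comm_ring_1 poly)" for m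
      by (simp add: monom_altdef)
    show ?thesis by (simp add: poly_const_pow X)
  qed
  then show ?thesis using assms by (simp add: coeff_sum sum.If_cases Int_def)
qed

lemma card_nontrivial_symmetric:
  "card {T. T \<in> nontrivial \<and> nodes T = n \<and> label T = i \<and> nmod T = j}
     = card {T. T \<in> nontrivial \<and> nodes T = n \<and> label T = j \<and> nmod T = i}"
proof -
  let ?S = "{T. T \<in> nontrivial \<and> nodes T = n}"
  \<comment> \<open>Over \<open>int poly poly\<close> the outer and the inner variable mark the two
    statistics independently, so coefficients count trees.\<close>
  have "[:0, 1:] \<noteq> (1 :: int poly poly)" "[:[:0, 1:]:] \<noteq> (1 :: int poly poly)"
    by (simp_all add: one_pCons)
  from gfB_symmetric[OF this]
  have "(\<Sum>T\<in>?S. [:0, 1:] ^ label T * [:[:0, 1::int:]:] ^ nmod T)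
      = (\<Sum>T\<in>?S. [:0, 1:] ^ nmod T * [:[:0, 1:]:] ^ label T)"
    by (simp only: fps_eq_iff gfB_def gf_nth mult.commute)
  from arg_cong[OF this, of "\<lambda>p. coeff (coeff p i) j"] show ?thesis
    unfolding coeff_sum_monom[OF finite_nontrivial] by (simp add: conj_ac)
qed

lemma card_beta01_symmetric:
  "card {T \<in> beta01_trees n. root_label T = i \<and> rmod T = j}
     = card {T \<in> beta01_trees n. root_label T = j \<and> rmod T = i}"
proof -
  have split: "{T \<in> beta01_trees n. root_label T = i \<and> rmod T = j}
      = {T. T \<in> nontrivial \<and> nodes T = n \<and> label T = i \<and> nmod T = j}
        \<union> (if n = 1 \<and> i = 0 \<and> j = 0 then {Node 0 []} else {})" for i j
  proof -
    have "T \<in> beta01_trees n \<longleftrightarrow> T \<in> nontrivial \<and> nodes T = n \<or> n = 1 \<and> T = Node 0 []" for T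
      using beta01_split[of n] by (auto simp: beta01_trees_def split: if_splits)
    then show ?thesis
      by (auto simp: root_label_def rmod_nontrivial rmod_def[of "Node 0 []"] split: if_splits)
  qed
  show ?thesis
  \<comment> \<open>The trivial tree has both statistics 0, so it occurs only on the diagonal, where
    the claim is reflexive.\<close>
  proof (cases "i = j")
    case False
    then have "\<not> (n = 1 \<and> i = 0 \<and> j = 0)" "\<not> (n = 1 \<and> j = 0 \<and> i = 0)" by auto
    then show ?thesis
      unfolding split by (simp only: if_False Un_empty_right card_nontrivial_symmetric[of n i j])
  qed simp
qed

theorem corollary12:
  fixes n :: nat and x y :: "'a :: comm_semiring_1"
  shows "(\<forall>i j. card {T \<in> beta01_trees n. (root_label T, rmod T) = (i, j)}
               = card {T \<in> beta01_trees n. (rmod T, root_label T) = (i, j)}) \<and>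
         (\<Sum>T\<in>beta01_trees n. x ^ root_label T * y ^ rmod T)
           = (\<Sum>T\<in>beta01_trees n. x ^ rmod T * y ^ root_label T)"
proof
  let ?S = "beta01_trees n"
  let ?f = "\<lambda>T. (root_label T, rmod T)" and ?g = "\<lambda>T. (rmod T, root_label T)"
  have card: "card {T \<in> ?S. ?f T = p} = card {T \<in> ?S. ?g T = p}" for p
    using card_beta01_symmetric[of n "fst p" "snd p"] by (cases p) (simp add: conj_commute)
  then show "\<forall>i j. card {T \<in> ?S. ?f T = (i, j)} = card {T \<in> ?S. ?g T = (i, j)}"
    by blast
  define h where "h = (\<lambda>(i, j). x ^ i * y ^ j)"
  \<comment> \<open>Grouping by the value of the pair leaves only cardinalities. The union of both
    images serves as a common index set for \<open>?f\<close> and \<open>?g\<close>.\<close>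
  have group: "(\<Sum>T\<in>?S. h (F T)) = (\<Sum>p\<in>?f ` ?S \<union> ?g ` ?S. of_nat (card {T \<in> ?S. F T = p}) * h p)"
    if "F ` ?S \<subseteq> ?f ` ?S \<union> ?g ` ?S" for F
  proof -
    have "(\<Sum>T\<in>?S. h (F T)) = (\<Sum>p\<in>?f ` ?S \<union> ?g ` ?S. \<Sum>T | T \<in> ?S \<and> F T = p. h (F T))"
      using that by (intro sum.group[symmetric]) (auto simp: finite_beta01_trees)
    then show ?thesis by simp
  qed
  have "(\<Sum>T\<in>?S. h (?f T)) = (\<Sum>T\<in>?S. h (?g T))"
    by (subst (1 2) group) (auto simp: card)
  then show "(\<Sum>T\<in>?S. x ^ root_label T * y ^ rmod T) = (\<Sum>T\<in>?S. x ^ rmod T * y ^ root_label T)"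
    by (simp add: h_def)
qed

end
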